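(* Let $\alpha,\gamma,\kappa>-1$ be real numbers with $\alpha+\kappa>-\frac32$. For $n,k\in\mathbb{N}_0$ let \[ S_{n,k}^{\alpha,\gamma,\kappa}(x,y)=(x+y)^{2k}P_n^{(2\alpha+2\kappa+4k+2,\gamma)}(1-2x-2y)\,P_k^{(\kappa,\alpha)}\left(1-2\frac{(x-y)^2}{(x+y)^2}\right). \] Then $\{S_{n,k}^{\alpha,\gamma,\kappa}(x,y):\ n,k\in\mathbb{N}_0\}$ is a mutually orthogonal polynomial system with respect to $w_{\alpha,\gamma,\kappa}$ on $\triangle$. Moreover, for all $n,k,m,l\in\mathbb{N}_0$, \[ b_{\alpha,\gamma,\kappa}\int_{\triangle}S_{n,k}^{\alpha,\gamma,\kappa}(x,y)\,S_{m,l}^{\alpha,\gamma,\kappa}(x,y)\,w_{\alpha,\gamma,\kappa}(x,y)\,dx\,dy=H_{n,k}^{\alpha,\gamma,\kappa}\,\delta_{n,m}\delta_{k,l}, \] where \[ b_{\alpha,\gamma,\kappa}=\left(\int_{\triangle}w_{\alpha,\gamma,\kappa}(x,y)\,dx\,dy\right)^{-1},\qquad \alpha_j=2\alpha+2\kappa+4j+2, \] and \[ \begin{aligned} H_{n,k}^{\alpha,\gamma,\kappa}&=\frac{(\alpha_0+1)_{4k}}{(\alpha_0+\gamma+2)_{4k}}\cdot\frac{(\alpha_k+1)_n(\gamma+1)_n(\alpha_k+\gamma+1)}{n!\,(\alpha_k+\gamma+1)_n(2n+\alpha_k+\gamma+1)}\\ &\quad\times\frac{(\kappa+1)_k(\alpha+1)_k(\alpha+\kappa+1)}{k!\,(\alpha+\kappa+1)_k(2k+\alpha+\kappa+1)}.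 \end{aligned} \] This formula is understood after cancelling the common factors at exceptional parameter values.
   Context: $\mathbb{N}_0$ is the set of nonnegative integers, $\delta$ is the Kronecker delta, and $(a)_0=1$, $(a)_j=a(a+1)\cdots(a+j-1)$ is the Pochhammer symbol. Let $\mathbf{T}^2=\{(x,y)\in\mathbb{R}^2:\ x\ge0,\ y\ge0,\ x+y\le1\}$, $\triangle=\{(x,y)\in\mathbf{T}^2:\ y<x\}$, and \[ w_{\alpha,\gamma,\kappa}(x,y)=(xy)^{\alpha}(1-x-y)^{\gamma}|x-y|^{2\kappa+1}. \] For $a,b>-1$ the Jacobi polynomial is \[ P_n^{(a,b)}(t)=\frac{1}{n!}\sum_{j=0}^n\binom{n}{j}(j+a+1)_{n-j}(n+a+b+1)_j\left(\frac{t-1}{2}\right)^j . \] The factor $(x+y)^{2k}$ clears the denominator in the argument of $P_k^{(\kappa,\alpha)}$, so $S_{n,k}^{\alpha,\gamma,\kappa}$ is a symmetric polynomial in $x$ and $y$. Cancellation convention in $H_{n,k}^{\alpha,\gamma,\kappa}$: for $s=\alpha_k+\gamma+1$ (with $j=n$) and $s=\alpha+\kappa+1$ (with $j=k$), the quotient $\dfrac{s}{(s)_j(2j+s)}$ is simplified by cancelling the common factor $s$ before specializing the parameters; in particular it equals $1$ when $j=0$, even if $s=0$. *)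

theory Defs
  imports "HOL-Analysis.Analysis"
begin

definition T2 :: "(real \<times> real) set" where
  "T2 = {(x, y). x \<ge> 0 \<and> y \<ge> 0 \<and> x + y \<le> 1}"

definition half_triangle :: "(real \<times> real) set" where
  "half_triangle = {(x, y). (x, y) \<in> T2 \<and> y < x}"

definition weight :: "real \<Rightarrow> real \<Rightarrow> real \<Rightarrow> real \<times> real \<Rightarrow> real" where
  "weight \<alpha> \<gamma> \<kappa> = (\<lambda>(x, y).
     (x * y) powr \<alpha> * (1 - x - y) powr \<gamma> * \<bar>x - y\<bar> powr (2 * \<kappa> + 1))"

definition jacobi :: "nat \<Rightarrow> real \<Rightarrow> real \<Rightarrow> real \<Rightarrow> real" where
  "jacobi n a b t = 1 / fact n *
     (\<Sum>j=0..n. real (n choose j) * pochhammer (real j + a + 1) (n - j)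
        * pochhammer (real n + a + b + 1) j * ((t - 1) / 2) ^ j)"

(* On the line x + y = 0, which does not meet half_triangle, the value of this expression is
   not that of the polynomial obtained by clearing the denominator when k > 0. *)
definition S :: "real \<Rightarrow> real \<Rightarrow> real \<Rightarrow> nat \<Rightarrow> nat \<Rightarrow> real \<times> real \<Rightarrow> real" where
  "S \<alpha> \<gamma> \<kappa> n k = (\<lambda>(x, y).
     (x + y) ^ (2 * k)
     * jacobi n (2 * \<alpha> + 2 * \<kappa> + 4 * real k + 2) \<gamma> (1 - 2 * x - 2 * y)
     * jacobi k \<kappa> \<alpha> (1 - 2 * ((x - y)\<^sup>2 / (x + y)\<^sup>2)))"

(* The integrability clause is needed because the integral of a non-integrable function is 0 by
   convention. Polynomiality is required on the domain D only: a polynomial in two variables is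
   determined by its values on a set D with nonempty interior. *)
definition mutually_orthogonal_polynomial_system ::
    "(real \<times> real \<Rightarrow> real) \<Rightarrow> (real \<times> real) set \<Rightarrow> ('i \<Rightarrow> real \<times> real \<Rightarrow> real) \<Rightarrow> bool" where
  "mutually_orthogonal_polynomial_system w D f \<longleftrightarrow>
     (\<forall>i. \<exists>p. real_polynomial_function p \<and> (\<forall>z\<in>D. f i z = p z)) \<and>
     (\<forall>i j. set_integrable lborel D (\<lambda>z. f i z * f j z * w z)) \<and>
     (\<forall>i. (LINT z:D|lborel. f i z * f i z * w z) > 0) \<and>
     (\<forall>i j. i \<noteq> j \<longrightarrow> (LINT z:D|lborel. f i z * f j z * w z) = 0)"

definition norm_const :: "real \<Rightarrow> real \<Rightarrow> real \<Rightarrow> real" where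
  "norm_const \<alpha> \<gamma> \<kappa> = inverse (LINT z:half_triangle|lborel. weight \<alpha> \<gamma> \<kappa> z)"

definition alpha_idx :: "real \<Rightarrow> real \<Rightarrow> nat \<Rightarrow> real" where
  "alpha_idx \<alpha> \<kappa> j = 2 * \<alpha> + 2 * \<kappa> + 4 * real j + 2"

(* The quotient s / ((s)_j (2 j + s)) after cancelling the common factor s. *)
definition cancelled_quot :: "real \<Rightarrow> nat \<Rightarrow> real" where
  "cancelled_quot s j =
     (if j = 0 then 1 else 1 / (pochhammer (s + 1) (j - 1) * (2 * real j + s)))"

lemma cancelled_quot_eq:
  assumes "s \<noteq> 0"
  shows "cancelled_quot s j = s / (pochhammer s j * (2 * real j + s))"
  using assms by (cases j) (simp_all add: cancelled_quot_def pochhammer_rec)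

definition H :: "real \<Rightarrow> real \<Rightarrow> real \<Rightarrow> nat \<Rightarrow> nat \<Rightarrow> real" where
  "H \<alpha> \<gamma> \<kappa> n k =
     pochhammer (alpha_idx \<alpha> \<kappa> 0 + 1) (4 * k) / pochhammer (alpha_idx \<alpha> \<kappa> 0 + \<gamma> + 2) (4 * k)
     * (pochhammer (alpha_idx \<alpha> \<kappa> k + 1) n * pochhammer (\<gamma> + 1) n / fact n
        * cancelled_quot (alpha_idx \<alpha> \<kappa> k + \<gamma> + 1) n)
     * (pochhammer (\<kappa> + 1) k * pochhammer (\<alpha> + 1) k / fact k
        * cancelled_quot (\<alpha> + \<kappa> + 1) k)"

end

theory Submission
  imports Defs
begin

text \<open>
  In the coordinates \<open>s = x + y\<close> and \<open>u = ((x - y) / (x + y))\<^sup>2\<close> the half triangle becomes the unit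
  square, the weight becomes the product of the beta weights with exponents
  \<open>(2 * \<alpha> + 2 * \<kappa> + 2, \<gamma>)\<close> in \<open>s\<close> and \<open>(\<kappa>, \<alpha>)\<close> in \<open>u\<close>, and each \<open>S\<close> becomes \<open>s ^ (2 * k)\<close> times a
  Jacobi polynomial in \<open>1 - 2 * s\<close> times one in \<open>1 - 2 * u\<close>. For \<open>k \<noteq> l\<close> the integral over \<open>u\<close> vanishes;
  for \<open>k = l\<close> the factor \<open>s ^ (4 * k)\<close> raises the first exponent to the one for which the polynomials
  in \<open>s\<close> are orthogonal. The orthogonality in one variable follows by integrating the explicit sum
  against \<open>(1 - u) ^ i\<close>, which the Chu-Vandermonde identity evaluates in closed form.
\<close>

subsection \<open>Jacobi polynomials on the unit interval\<close>

text \<open>The indicator turns it into a function on the whole line, so integrals are taken over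
  \<open>lborel\<close> and values of \<open>powr\<close> outside the unit interval never
  matter.\<close>

definition beta_weight :: "real \<Rightarrow> real \<Rightarrow> real \<Rightarrow> real" where
  "beta_weight a b u = indicator {0..1} u * (u powr a * (1 - u) powr b)"

lemma beta_weight_nonneg: "beta_weight a b u \<ge> 0"
  by (simp add: beta_weight_def)

lemma borel_measurable_beta_weight [measurable]: "beta_weight a b \<in> borel_measurable borel"
  unfolding beta_weight_def by measurable

lemma has_bochner_integral_beta_weight:
  assumes "a > -1" "b > -1"
  shows "has_bochner_integral lborel (beta_weight a b) (Beta (a + 1) (b + 1))"
proof -
  have *: "set_integrable lborel {0..1} (\<lambda>u. u powr a * (1 - u) powr b)"
    using integrable_Beta[of "a + 1" "b + 1"] assms by simp
  have "((\<lambda>u. u powr a * (1 - u) powr b) has_integral Beta (a + 1) (b + 1)) {0..1}"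
    using has_integral_Beta_real[of "a + 1" "b + 1"] assms by simp
  hence "(LINT u:{0..1}|lborel. u powr a * (1 - u) powr b) = Beta (a + 1) (b + 1)"
    using set_borel_integral_eq_integral(2)[OF *] by (simp add: integral_unique)
  with * show ?thesis
    unfolding has_bochner_integral_iff set_integrable_def set_lebesgue_integral_def beta_weight_def
    by simp
qed

lemma beta_weight_mult_power:
  "beta_weight a b u * (u ^ j * (1 - u) ^ i) = beta_weight (a + real j) (b + real i) u"
proof -
  \<comment> \<open>At x = 0 both sides vanish, since \<open>0 powr c = 0\<close> for every c,
    including c = 0 with n = 0.\<close>
  have *: "x powr c * x ^ n = x powr (c + real n)" if "x \<ge> 0" for x c n
    using that by (cases "x = 0") (auto simp: powr_add powr_realpow)
  have "u powr a * (1 - u) powr b * (u ^ j * (1 - u) ^ i)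
      = u powr (a + real j) * (1 - u) powr (b + real i)" if "u \<in> {0..1}"
    using that by (simp flip: *)
  thus ?thesis
    by (simp add: beta_weight_def mult.assoc split: split_indicator)
qed

text \<open>Each of the three Gamma factors of the Beta function, shifted by a natural number, picks
  up a Pochhammer symbol.\<close>

lemma Beta_add_nat:
  fixes a b :: real
  assumes "a > 0" "b > 0"
  shows "Beta (a + real j) (b + real i)
           = Beta a b * pochhammer a j * pochhammer b i / pochhammer (a + b) (i + j)"
proof -
  have *: "Gamma (x + real n) = pochhammer x n * Gamma x" if "x > 0" for x n
  proof -
    have "x \<notin> \<int>\<^sub>\<le>\<^sub>0" using that by (auto elim!: nonpos_Ints_cases)
    thus ?thesis
      using that pochhammer_Gamma[of x n] Gamma_real_pos[of x] by (simp add: less_imp_neq[symmetric])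
  qed
  have "Gamma (a + real j + (b + real i)) = pochhammer (a + b) (i + j) * Gamma (a + b)"
    using *[of "a + b" "i + j"] assms by (simp add: algebra_simps)
  with *[of a j] *[of b i] assms show ?thesis
    by (simp add: Beta_def mult_ac)
qed

text \<open>Reflection \<open>refl\<close> absorbs the alternating sign and turns the shifted symbol
  into one with fixed base 1 - C - n. The binomial theorem for Pochhammer symbols then sums the
  series, and a second reflection restores the base C - A.\<close>

lemma Chu_Vandermonde:
  fixes A C :: real
  shows "(\<Sum>j\<le>n. (-1) ^ j * real (n choose j) * pochhammer A j * pochhammer (C + real j) (n - j))
           = pochhammer (C - A) n"
proof -
  have refl: "pochhammer x k = (-1) ^ k * pochhammer (1 - x - real k) k" for x :: real and k
    using pochhammer_minus[of "- x" k] by (simp add: algebra_simps)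
  have "(-1) ^ j * pochhammer (C + real j) (n - j)
          = (-1) ^ n * pochhammer (1 - C - real n) (n - j)" if "j \<le> n" for j
    using that refl[of "C + real j" "n - j"]
    by (simp add: of_nat_diff algebra_simps flip: power_add)
  hence "(\<Sum>j\<le>n. (-1) ^ j * real (n choose j) * pochhammer A j * pochhammer (C + real j) (n - j))
      = (\<Sum>j\<le>n. (-1) ^ n * (real (n choose j) * pochhammer A j * pochhammer (1 - C - real n) (n - j)))"
    by (intro sum.cong) (auto simp: mult_ac)
  also have "\<dots> = (-1) ^ n * pochhammer (A + (1 - C - real n)) n"
    by (simp add: pochhammer_binomial_sum sum_distrib_left)
  also have "\<dots> = pochhammer (C - A) n"
    using refl[of "C - A" n] by (simp add: algebra_simps)
  finally show ?thesis .
qed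

section \<open>Moments of Jacobi polynomials against the beta weight\<close>

definition jacobi_coeff :: "nat \<Rightarrow> real \<Rightarrow> real \<Rightarrow> nat \<Rightarrow> real" where
  "jacobi_coeff n a b j = (-1) ^ j * real (n choose j) * pochhammer (real j + a + 1) (n - j)
     * pochhammer (real n + a + b + 1) j / fact n"

lemma jacobi_eq_sum: "jacobi n a b (1 - 2 * u) = (\<Sum>j\<le>n. jacobi_coeff n a b j * u ^ j)"
proof -
  have "((1 - 2 * u - 1) / 2) ^ j = (-1) ^ j * u ^ j" for j
    by (simp flip: power_mult_distrib)
  thus ?thesis
    by (simp add: jacobi_def jacobi_coeff_def atMost_atLeast0 sum_divide_distrib mult_ac)
qed

text \<open>Termwise this is a sum of Beta integrals, which becomes a Chu-Vandermonde sum. The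
  factor \<open>pochhammer (real i + 1 - real n) n\<close> carries the orthogonality: it is a
  product of n consecutive integers that contains 0 when i < n.\<close>

lemma jacobi_moment:
  assumes "a > -1" "b > -1"
  shows "has_bochner_integral lborel
     (\<lambda>u. beta_weight a b u * (jacobi n a b (1 - 2 * u) * (1 - u) ^ i))
     (Beta (a + 1) (b + 1) * pochhammer (a + 1) n * pochhammer (b + 1) i
        * pochhammer (real i + 1 - real n) n / (fact n * pochhammer (a + b + 2) (i + n)))"
    (is "has_bochner_integral _ ?f ?I")
proof -
  define c where "c = a + b + 1"
  have c: "c + 1 > 0" using assms by (simp add: c_def)
  have "has_bochner_integral lborel
      (\<lambda>u. \<Sum>j\<le>n. jacobi_coeff n a b j * beta_weight (a + real j) (b + real i) u)
      (\<Sum>j\<le>n. jacobi_coeff n a b j * Beta (a + real j + 1) (b + real i + 1))"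
    using assms
    by (intro has_bochner_integral_sum has_bochner_integral_mult_right
              has_bochner_integral_beta_weight) auto
  moreover have "(\<lambda>u. \<Sum>j\<le>n. jacobi_coeff n a b j * beta_weight (a + real j) (b + real i) u) = ?f"
    unfolding jacobi_eq_sum beta_weight_mult_power[symmetric]
    by (simp add: sum_distrib_left sum_distrib_right mult_ac)
  moreover have "(\<Sum>j\<le>n. jacobi_coeff n a b j * Beta (a + real j + 1) (b + real i + 1)) = ?I"
  proof -
    have "jacobi_coeff n a b j * Beta (a + real j + 1) (b + real i + 1) =
        Beta (a + 1) (b + 1) * pochhammer (a + 1) n * pochhammer (b + 1) i
          / (fact n * pochhammer (c + 1) (i + n))
        * ((-1) ^ j * real (n choose j) * pochhammer (real n + c) j
             * pochhammer (c + 1 + real i + real j) (n - j))" if j: "j \<le> n" for j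
    proof -
      \<comment> \<open>Splitting both symbols at j isolates a factor independent of j from a
        summand of the Chu-Vandermonde form.\<close>
      have 1: "pochhammer (a + 1) n = pochhammer (a + 1) j * pochhammer (real j + a + 1) (n - j)"
        using pochhammer_product[OF j, of "a + 1"] by (simp add: add_ac)
      have 2: "pochhammer (c + 1) (i + n)
          = pochhammer (c + 1) (i + j) * pochhammer (c + 1 + real i + real j) (n - j)"
        using pochhammer_product[of "i + j" "i + n" "c + 1"] j by (simp add: add_ac)
      have 3: "Beta (a + real j + 1) (b + real i + 1) = Beta (a + 1) (b + 1)
          * pochhammer (a + 1) j * pochhammer (b + 1) i / pochhammer (c + 1) (i + j)"
        using Beta_add_nat[of "a + 1" "b + 1" j i] assms by (simp add: c_def add_ac)
      have "pochhammer (c + 1) (i + j) > 0" "pochhammer (c + 1 + real i + real j) (n - j) > 0"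
        using c by (auto intro!: pochhammer_pos)
      thus ?thesis
        unfolding 1 2 3 by (simp add: jacobi_coeff_def c_def add_ac field_simps)
    qed
    hence "(\<Sum>j\<le>n. jacobi_coeff n a b j * Beta (a + real j + 1) (b + real i + 1)) =
        Beta (a + 1) (b + 1) * pochhammer (a + 1) n * pochhammer (b + 1) i
          / (fact n * pochhammer (c + 1) (i + n))
        * (\<Sum>j\<le>n. (-1) ^ j * real (n choose j) * pochhammer (real n + c) j
             * pochhammer (c + 1 + real i + real j) (n - j))"
      by (simp add: sum_distrib_left)
    \<comment> \<open>Here A = n + c and C = c + 1 + i, so C - A = i + 1 - n.\<close>
    also have "(\<Sum>j\<le>n. (-1) ^ j * real (n choose j) * pochhammer (real n + c) j
             * pochhammer (c + 1 + real i + real j) (n - j)) = pochhammer (real i + 1 - real n) n"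
      unfolding Chu_Vandermonde by (simp add: algebra_simps)
    finally show ?thesis by (simp add: c_def add_ac)
  qed
  ultimately show ?thesis by simp
qed

text \<open>Expanding u^j in powers of 1 - u leaves only moments with i <= j <= n, and those with i
  < n vanish. For j = n the single term i = n survives, with sign (-1)^n.\<close>

lemma jacobi_moment_power:
  assumes "a > -1" "b > -1" "j \<le> n"
  shows "has_bochner_integral lborel
     (\<lambda>u. beta_weight a b u * (jacobi n a b (1 - 2 * u) * u ^ j))
     (if j = n then (-1) ^ n * (Beta (a + 1) (b + 1) * pochhammer (a + 1) n * pochhammer (b + 1) n
        / pochhammer (a + b + 2) (n + n)) else 0)" (is "has_bochner_integral _ _ ?K")
proof -
  define M where "M = (\<lambda>i. Beta (a + 1) (b + 1) * pochhammer (a + 1) n * pochhammer (b + 1) i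
        * pochhammer (real i + 1 - real n) n / (fact n * pochhammer (a + b + 2) (i + n)))"
  have M0: "M i = 0" if "i < n" for i
  proof -
    have "pochhammer (real i + 1 - real n) n = pochhammer (- real (n - 1 - i)) n"
      using that by (simp add: of_nat_diff algebra_simps)
    also have "\<dots> = 0" using that by (intro pochhammer_of_nat_eq_0_lemma) auto
    finally show ?thesis by (simp add: M_def)
  qed
  \<comment> \<open>At i = n the symbol that vanished before is (1)_n = n!, which cancels
    \<open>fact n\<close>.\<close>
  have Mn: "M n = Beta (a + 1) (b + 1) * pochhammer (a + 1) n * pochhammer (b + 1) n
        / pochhammer (a + b + 2) (n + n)"
    by (simp add: M_def pochhammer_fact[symmetric])
  have pw: "u ^ j = (\<Sum>i\<le>j. real (j choose i) * (-1) ^ i * (1 - u) ^ i)" for u :: real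
  proof -
    have "u ^ j = (\<Sum>i\<le>j. real (j choose i) * (- (1 - u)) ^ i)"
      using binomial_ring[of "- (1 - u)" 1 j] by simp
    thus ?thesis unfolding power_minus[of "1 - u"] by (simp only: mult.assoc)
  qed
  have "has_bochner_integral lborel
     (\<lambda>u. \<Sum>i\<le>j. real (j choose i) * (-1) ^ i
        * (beta_weight a b u * (jacobi n a b (1 - 2 * u) * (1 - u) ^ i)))
     (\<Sum>i\<le>j. real (j choose i) * (-1) ^ i * M i)"
    unfolding M_def using assms
    by (intro has_bochner_integral_sum has_bochner_integral_mult_right jacobi_moment)
  moreover have "(\<Sum>i\<le>j. real (j choose i) * (-1) ^ i * M i) = ?K"
  proof (cases "j = n")
    case True
    have "(\<Sum>i\<le>n. real (n choose i) * (-1) ^ i * M i) = (\<Sum>i\<in>{n}. real (n choose i) * (-1) ^ i * M i)"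
      using M0 by (intro sum.mono_neutral_right) auto
    thus ?thesis using True Mn by simp
  qed (use M0 assms in auto)
  ultimately show ?thesis
    by (simp add: pw sum_distrib_left mult_ac)
qed

section \<open>Squared norms and orthogonality in one variable\<close>

definition jacobi_norm :: "nat \<Rightarrow> real \<Rightarrow> real \<Rightarrow> real" where
  "jacobi_norm n a b = pochhammer (a + 1) n * pochhammer (b + 1) n / fact n
     * cancelled_quot (a + b + 1) n"

lemma jacobi_norm_pos:
  assumes "a > -1" "b > -1"
  shows "jacobi_norm n a b > 0"
proof -
  have "cancelled_quot (a + b + 1) n > 0"
  proof (cases n)
    case (Suc m)
    have "pochhammer (a + b + 1 + 1) m * (2 * (1 + real m) + (a + b + 1)) > 0"
      using assms by (intro mult_pos_pos pochhammer_pos) auto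
    thus ?thesis using Suc by (simp add: cancelled_quot_def)
  qed (simp add: cancelled_quot_def)
  thus ?thesis
    using assms by (auto simp: jacobi_norm_def intro!: mult_pos_pos divide_pos_pos pochhammer_pos)
qed

text \<open>The right side is what the integration yields: leading coefficient times top moment, up
  to signs and the Beta factor. With n = m + 1, splitting (a + b + 2)_{2n} after m factors leaves (n
  + a + b + 1)_n (2n + a + b + 1), whose first factor cancels.\<close>

lemma jacobi_norm_eq:
  assumes "a > -1" "b > -1"
  shows "jacobi_norm n a b = pochhammer (real n + a + b + 1) n / fact n
     * (pochhammer (a + 1) n * pochhammer (b + 1) n / pochhammer (a + b + 2) (n + n))"
proof (cases n)
  case (Suc m)
  have "pochhammer (a + b + 2) (n + n)
     = pochhammer (a + b + 2) m * pochhammer (a + b + 2 + real m) (Suc n)"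
    using pochhammer_product'[of "a + b + 2" m "Suc n"] Suc by simp
  also have "pochhammer (a + b + 2 + real m) (Suc n)
     = pochhammer (real n + a + b + 1) n * (2 * real n + (a + b + 1))"
    using Suc by (simp add: pochhammer_Suc add_ac)
  finally have *: "pochhammer (a + b + 2) (n + n) = pochhammer (a + b + 2) m
      * (pochhammer (real n + a + b + 1) n * (2 * real n + (a + b + 1)))" .
  have "pochhammer (real n + a + b + 1) n > 0" "pochhammer (a + b + 2) m > 0"
    "2 * real n + (a + b + 1) > 0"
    using assms Suc by (auto intro!: pochhammer_pos)
  thus ?thesis
    unfolding * by (simp add: jacobi_norm_def cancelled_quot_def Suc add.commute[of 2] del: pochhammer_Suc)
qed (simp add: jacobi_norm_def cancelled_quot_def)

text \<open>Only the polynomial of lower degree is expanded. Its powers u^j have j <= m <= n, so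
  nothing but j = n = m contributes.\<close>

lemma jacobi_orthogonal_aux:
  assumes "a > -1" "b > -1" "m \<le> n"
  shows "has_bochner_integral lborel
     (\<lambda>u. beta_weight a b u * (jacobi n a b (1 - 2 * u) * jacobi m a b (1 - 2 * u)))
     (if n = m then Beta (a + 1) (b + 1) * jacobi_norm n a b else 0)"
proof -
  define K where "K = Beta (a + 1) (b + 1) * pochhammer (a + 1) n * pochhammer (b + 1) n
        / pochhammer (a + b + 2) (n + n)"
  have "has_bochner_integral lborel
     (\<lambda>u. \<Sum>j\<le>m. jacobi_coeff m a b j
        * (beta_weight a b u * (jacobi n a b (1 - 2 * u) * u ^ j)))
     (\<Sum>j\<le>m. jacobi_coeff m a b j * (if j = n then (-1) ^ n * K else 0))"
    unfolding K_def using assms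
    by (intro has_bochner_integral_sum has_bochner_integral_mult_right jacobi_moment_power) auto
  moreover have "(\<Sum>j\<le>m. jacobi_coeff m a b j * (if j = n then (-1) ^ n * K else 0))
      = (if n = m then Beta (a + 1) (b + 1) * jacobi_norm n a b else 0)"
  proof (cases "n = m")
    case True
    \<comment> \<open>The sign of the leading coefficient cancels the sign of the top
      moment.\<close>
    have "jacobi_coeff n a b n * ((-1) ^ n * K) = Beta (a + 1) (b + 1) * jacobi_norm n a b"
      unfolding jacobi_norm_eq[OF assms(1,2)]
      by (simp add: jacobi_coeff_def K_def mult_ac flip: power_mult_distrib)
    with True show ?thesis by (simp add: sum.delta' if_distrib cong: if_cong)
  qed (use assms in \<open>auto intro!: sum.neutral\<close>)
  ultimately show ?thesis
    unfolding jacobi_eq_sum[of m] by (simp add: sum_distrib_left mult.left_commute)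
qed

lemma jacobi_orthogonal:
  assumes "a > -1" "b > -1"
  shows "has_bochner_integral lborel
     (\<lambda>u. beta_weight a b u * (jacobi n a b (1 - 2 * u) * jacobi m a b (1 - 2 * u)))
     (if n = m then Beta (a + 1) (b + 1) * jacobi_norm n a b else 0)"
proof (cases "m \<le> n")
  case False
  thus ?thesis
    using jacobi_orthogonal_aux[OF assms, of n m]
    by (simp add: mult.commute[of "jacobi m a b _"])
qed (use jacobi_orthogonal_aux[OF assms] in blast)

subsection \<open>Integration over the half triangle\<close>

text \<open>Passing from (x, y) to (s, y) with s = x + y preserves area: by Tonelli, for fixed y it
  is a translation in the first coordinate.\<close>

lemma distr_lborel_shear:
  "distr (lborel :: (real \<times> real) measure) lborel (\<lambda>(s, y). (s - y, y)) = lborel"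
proof (rule measure_eqI)
  define T where "T = (\<lambda>(s, y). (s - y, y) :: real \<times> real)"
  have T [measurable]: "T \<in> borel \<Otimes>\<^sub>M borel \<rightarrow>\<^sub>M borel \<Otimes>\<^sub>M borel"
    unfolding T_def by measurable
  have T' [measurable]: "T \<in> borel \<rightarrow>\<^sub>M borel"
    using T unfolding borel_prod .
  fix A :: "(real \<times> real) set"
  assume "A \<in> sets (distr lborel lborel (\<lambda>(s, y). (s - y, y)))"
  hence A': "A \<in> sets borel" by simp
  hence [measurable]: "A \<in> sets (borel \<Otimes>\<^sub>M borel)" unfolding borel_prod .
  have "emeasure (distr lborel lborel T) A = (\<integral>\<^sup>+ p. indicator A p \<partial>distr lborel lborel T)"
    using A' by simp
  also have "\<dots> = (\<integral>\<^sup>+ p. indicator A (T p) \<partial>(lborel \<Otimes>\<^sub>M lborel))"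
    unfolding lborel_prod by (rule nn_integral_distr) (use T' A' in simp_all)
  also have "\<dots> = (\<integral>\<^sup>+ y. \<integral>\<^sup>+ s. indicator A (T (s, y)) \<partial>lborel \<partial>lborel)"
    by (rule lborel_pair.nn_integral_snd[symmetric]) measurable
  also have "\<dots> = (\<integral>\<^sup>+ y. \<integral>\<^sup>+ x. indicator A (x, y) \<partial>lborel \<partial>lborel)"
  proof (rule nn_integral_cong)
    fix y :: real
    show "(\<integral>\<^sup>+ s. indicator A (T (s, y)) \<partial>lborel) = (\<integral>\<^sup>+ x. indicator A (x, y) \<partial>lborel)"
      using nn_integral_real_affine[of "\<lambda>x. indicator A (x, y)" 1 "- y"] by (simp add: T_def)
  qed
  also have "\<dots> = (\<integral>\<^sup>+ p. indicator A p \<partial>(lborel \<Otimes>\<^sub>M lborel))"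
    by (rule lborel_pair.nn_integral_snd) measurable
  also have "\<dots> = emeasure lborel A"
    unfolding lborel_prod using A' by simp
  finally show "emeasure (distr lborel lborel (\<lambda>(s, y). (s - y, y))) A = emeasure lborel A"
    by (simp add: T_def)
qed simp

text \<open>Substitution u = r^2. The variable r = (x - y) / (x + y) is affine in y on each line x +
  y = s, so the fibre integral afterwards needs only an affine change of variable.\<close>

lemma has_bochner_integral_beta_weight_square:
  assumes "has_bochner_integral lborel (\<lambda>u. beta_weight \<kappa> \<alpha> u * h u) J"
  shows "has_bochner_integral lborel
     (\<lambda>r. indicator {0..1} r * (r powr (2 * \<kappa> + 1) * (1 - r\<^sup>2) powr \<alpha> * h (r\<^sup>2))) (J / 2)"
proof -
  define f where "f = (\<lambda>u. u powr \<kappa> * (1 - u) powr \<alpha> * h u)"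
  have f: "has_bochner_integral lborel (\<lambda>u. indicator {0..1} u * f u) J"
    using assms by (simp add: f_def beta_weight_def mult.assoc)
  \<comment> \<open>The endpoints stay unevaluated to match the shape g a, g b of the substitution
    rule.\<close>
  have *: "set_integrable lborel {0\<^sup>2..1\<^sup>2::real} f"
    using f by (simp add: set_integrable_def has_bochner_integral_iff)
  note sub = integral_substitution[where g = "\<lambda>r. r\<^sup>2" and g' = "\<lambda>r. 2 * r" and a = 0 and b = 1, OF *]
  have der: "((\<lambda>r. r\<^sup>2) has_real_derivative 2 * x) (at x)" for x :: real
    by (auto intro!: derivative_eq_intros)
  have "set_integrable lborel {0..1} (\<lambda>r. f (r\<^sup>2) * (2 * r))"
    by (rule sub(1)) (auto intro!: der continuous_intros)
  moreover have "(LBINT x. f x * indicator {0\<^sup>2..1\<^sup>2} x)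
      = (LBINT r. f (r\<^sup>2) * (2 * r) * indicator {0..1} r)"
    by (rule sub(2)) (auto intro!: der continuous_intros)
  ultimately have "has_bochner_integral lborel (\<lambda>r. indicator {0..1} r * (f (r\<^sup>2) * (2 * r))) J"
    using f by (simp add: set_integrable_def has_bochner_integral_iff mult.commute)
  hence "has_bochner_integral lborel (\<lambda>r. (1 / 2) * (indicator {0..1} r * (f (r\<^sup>2) * (2 * r)))) ((1 / 2) * J)"
    by (rule has_bochner_integral_mult_right)
  moreover have "(1 / 2) * (indicator {0..1} r * (f (r\<^sup>2) * (2 * r)))
      = indicator {0..1} r * (r powr (2 * \<kappa> + 1) * (1 - r\<^sup>2) powr \<alpha> * h (r\<^sup>2))" for r :: real
  \<comment> \<open>For r < 0 the indicator is 0; at r = 0 both sides are 0, the right one because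
    \<open>0 powr (2 * \<kappa> + 1) = 0\<close> even for a negative exponent.\<close>
  proof (cases "r > 0")
    case True
    have "(r\<^sup>2) powr \<kappa> * r = r powr (2 * \<kappa> + 1)"
      using True powr_add[of r "2 * \<kappa>" 1]
      by (simp add: power2_eq_square powr_mult flip: powr_add)
    thus ?thesis by (simp add: f_def mult_ac)
  qed (auto simp: f_def split: split_indicator)
  ultimately show ?thesis by (simp only: mult_1 times_divide_eq_left)
qed

text \<open>A general separated integrand: G = h = 1 gives the weight alone, products of Jacobi
  polynomials give the products of two \<open>S\<close>, and absolute values give the bound that
  Fubini requires.\<close>

definition polar_integrand ::
    "real \<Rightarrow> real \<Rightarrow> real \<Rightarrow> (real \<Rightarrow> real) \<Rightarrow> (real \<Rightarrow> real) \<Rightarrow> real \<times> real \<Rightarrow> real" where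
  "polar_integrand \<alpha> \<gamma> \<kappa> G h z = indicator half_triangle z
     * (weight \<alpha> \<gamma> \<kappa> z * (G (fst z + snd z) * h (((fst z - snd z) / (fst z + snd z))\<^sup>2)))"

lemma half_triangle_borel: "half_triangle \<in> sets (borel \<Otimes>\<^sub>M borel)"
proof -
  have "half_triangle = {z \<in> space (borel \<Otimes>\<^sub>M borel). 0 \<le> fst z \<and> 0 \<le> snd z
      \<and> fst z + snd z \<le> 1 \<and> snd z < fst z}"
    by (auto simp: half_triangle_def T2_def space_pair_measure)
  also have "\<dots> \<in> sets (borel \<Otimes>\<^sub>M borel)" by measurable
  finally show ?thesis .
qed

lemma borel_measurable_polar_integrand:
  assumes [measurable]: "G \<in> borel_measurable borel" "h \<in> borel_measurable borel"
  shows "polar_integrand \<alpha> \<gamma> \<kappa> G h \<in> borel_measurable (borel \<Otimes>\<^sub>M borel)"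
  unfolding polar_integrand_def weight_def
  using half_triangle_borel by measurable

text \<open>Substitution of \<open>y = s / 2 * (1 - r)\<close> on the line \<open>x + y = s\<close>, so that \<open>x - y = s * r\<close>.\<close>

lemma polar_fibre:
  assumes "has_bochner_integral lborel
     (\<lambda>r. indicator {0..1} r * (r powr (2 * \<kappa> + 1) * (1 - r\<^sup>2) powr \<alpha> * h (r\<^sup>2))) J"
  shows "has_bochner_integral lborel (\<lambda>y. polar_integrand \<alpha> \<gamma> \<kappa> G h (s - y, y))
     (beta_weight (2 * \<alpha> + 2 * \<kappa> + 2) \<gamma> s * G s * (J / 2 powr (2 * \<alpha> + 1)))"
\<comment> \<open>For other s the line x + y = s misses the half triangle, and the beta weight
  vanishes too, at s = 0 because \<open>0 powr _ = 0\<close>.\<close>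
proof (cases "s \<in> {0<..1}")
  case False
  hence "polar_integrand \<alpha> \<gamma> \<kappa> G h (s - y, y) = 0" for y
    by (auto simp: polar_integrand_def half_triangle_def T2_def)
  moreover have "beta_weight (2 * \<alpha> + 2 * \<kappa> + 2) \<gamma> s = 0"
    using False by (cases "s = 0") (auto simp: beta_weight_def)
  ultimately show ?thesis by (simp add: has_bochner_integral_zero)
next
  case True
  hence s: "s > 0" "s \<le> 1" by auto
  \<comment> \<open>\<open>D\<close> collects the factors that do not depend on r. The Jacobian s /
    2 of the affine substitution later supplies the missing power of s and the missing factor 1 /
    2.\<close>
  define D where "D = (1 - s) powr \<gamma> * G s * s powr (2 * \<alpha> + 2 * \<kappa> + 1) / 2 powr (2 * \<alpha>)"
  have eq: "polar_integrand \<alpha> \<gamma> \<kappa> G h (s - (s / 2 + (- s / 2) * r), s / 2 + (- s / 2) * r)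
      = D * (indicator {0..1} r * (r powr (2 * \<kappa> + 1) * (1 - r\<^sup>2) powr \<alpha> * h (r\<^sup>2)))" for r
  proof -
    define y where "y = s / 2 + (- s / 2) * r"
    define x where "x = s - y"
    have x: "x = s / 2 * (1 + r)" and y: "y = s / 2 * (1 - r)"
      by (simp_all add: x_def y_def field_simps)
    have sum: "x + y = s" and diff: "x - y = s * r" by (simp_all add: x y field_simps)
    have ind: "(x, y) \<in> half_triangle \<longleftrightarrow> 0 < r \<and> r \<le> 1"
    proof -
      have "y \<ge> 0 \<longleftrightarrow> r \<le> 1" using s by (simp add: y zero_le_mult_iff)
      moreover have "y < x \<longleftrightarrow> 0 < r"
        using diff s by (metis diff_gt_0_iff_gt zero_less_mult_pos mult_pos_pos)
      ultimately show ?thesis using sum s by (auto simp: half_triangle_def T2_def)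
    qed
    show ?thesis
    proof (cases "0 < r \<and> r \<le> 1")
      case True
      have "x * y = (s / 2) * (s / 2) * (1 - r\<^sup>2)"
        by (simp add: x y power2_eq_square algebra_simps)
      moreover have "1 - r\<^sup>2 \<ge> 0" using True by (simp add: power_le_one)
      moreover note powr_mult[of "(s / 2) * (s / 2)" "1 - r\<^sup>2" \<alpha>]
      moreover note powr_mult[of "s / 2" "s / 2" \<alpha>]
      ultimately have "(x * y) powr \<alpha> = (s / 2) powr \<alpha> * (s / 2) powr \<alpha> * (1 - r\<^sup>2) powr \<alpha>"
        using s by (simp only:)
      also have "(s / 2) powr \<alpha> * (s / 2) powr \<alpha> = s powr (2 * \<alpha>) / 2 powr (2 * \<alpha>)"
        using s by (simp add: powr_divide flip: powr_add)
      finally have xy: "(x * y) powr \<alpha> = s powr (2 * \<alpha>) / 2 powr (2 * \<alpha>) * (1 - r\<^sup>2) powr \<alpha>" .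
      have ab: "\<bar>x - y\<bar> powr (2 * \<kappa> + 1) = s powr (2 * \<kappa> + 1) * r powr (2 * \<kappa> + 1)"
        using True s by (simp add: diff abs_mult powr_mult)
      have ss: "s powr (2 * \<alpha> + 2 * \<kappa> + 1) = s powr (2 * \<alpha>) * s powr (2 * \<kappa> + 1)"
        by (simp add: add.assoc flip: powr_add)
      have rr: "(x - y) / s = r" using s by (simp add: diff)
      have s1: "1 - x - y = 1 - s" using sum by simp
      show ?thesis
        unfolding y_def[symmetric] x_def[symmetric] polar_integrand_def weight_def D_def
        using True ind by (simp add: xy ab ss rr s1 sum)
    next
      \<comment> \<open>At r = 0 the point lies on the excluded diagonal although the indicator of
        \<open>{0..1}\<close> is 1; \<open>0 powr _ = 0\<close> makes both sides agree.\<close>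
      case False
      hence "indicator {0..1} r * r powr (2 * \<kappa> + 1) = 0"
        by (cases "r = 0") (auto simp: indicator_def)
      thus ?thesis
        unfolding y_def[symmetric] x_def[symmetric] polar_integrand_def
        using False ind by (simp add: mult.assoc[symmetric])
    qed
  qed
  have "has_bochner_integral lborel
      (\<lambda>r. polar_integrand \<alpha> \<gamma> \<kappa> G h (s - (s / 2 + (- s / 2) * r), s / 2 + (- s / 2) * r)) (D * J)"
    unfolding eq by (rule has_bochner_integral_mult_right[OF assms])
  moreover have "D * J = (beta_weight (2 * \<alpha> + 2 * \<kappa> + 2) \<gamma> s * G s * (J / 2 powr (2 * \<alpha> + 1)))
      /\<^sub>R \<bar>- s / 2\<bar>"
  proof -
    have "s powr (2 * \<alpha> + 2 * \<kappa> + 2) = s powr (2 * \<alpha> + 2 * \<kappa> + 1) * s"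
      using s powr_add[of s "2 * \<alpha> + 2 * \<kappa> + 1" 1] by (simp add: add_ac)
    moreover have "2 powr (2 * \<alpha> + 1) = 2 powr (2 * \<alpha>) * (2 :: real)"
      by (simp add: powr_add)
    ultimately show ?thesis using s by (simp add: D_def beta_weight_def field_simps)
  qed
  ultimately show ?thesis
    using s by (subst lborel_has_bochner_integral_real_affine_iff[of "- s / 2" _ _ "s / 2"]) simp_all
qed

text \<open>Fubini in (s, y): each fibre integral is a constant multiple of the integrand in s, so
  the double integral factors. The power of 2 combines \<open>2 powr (2 * \<alpha> + 1)\<close> from
  the fibre with the 2 from du = 2 r dr.\<close>

lemma has_bochner_integral_polar:
  assumes [measurable]: "G \<in> borel_measurable borel" "h \<in> borel_measurable borel"
    and I: "has_bochner_integral lborel (\<lambda>s. beta_weight (2 * \<alpha> + 2 * \<kappa> + 2) \<gamma> s * G s) I"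
    and J: "has_bochner_integral lborel (\<lambda>u. beta_weight \<kappa> \<alpha> u * h u) J"
  shows "has_bochner_integral lborel (polar_integrand \<alpha> \<gamma> \<kappa> G h) (I * J / 2 powr (2 * \<alpha> + 2))"
proof -
  define c where "c = 1 / (2 * 2 powr (2 * \<alpha> + 1))"
  have c: "2 powr (2 * \<alpha> + 2) = 2 * 2 powr (2 * \<alpha> + 1)"
    using powr_add[of 2 "2 * \<alpha> + 1" 1] by (simp add: add.commute)
  note [measurable] = borel_measurable_polar_integrand
  have abs: "has_bochner_integral lborel (\<lambda>x. beta_weight a b x * \<bar>f x\<bar>)
      (LBINT x. \<bar>beta_weight a b x * f x\<bar>)"
    if "has_bochner_integral lborel (\<lambda>x. beta_weight a b x * f x) K" for a b f K
    using integrable_abs[of lborel "\<lambda>x. beta_weight a b x * f x"] that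
    by (simp add: has_bochner_integral_iff abs_mult beta_weight_nonneg)
  obtain I' where I': "has_bochner_integral lborel
      (\<lambda>s. beta_weight (2 * \<alpha> + 2 * \<kappa> + 2) \<gamma> s * \<bar>G s\<bar>) I'"
    using abs[OF I] by blast
  obtain J' where J': "has_bochner_integral lborel (\<lambda>u. beta_weight \<kappa> \<alpha> u * \<bar>h u\<bar>) J'"
    using abs[OF J] by blast
  note fibre = polar_fibre[OF has_bochner_integral_beta_weight_square]
  \<comment> \<open>The absolute value is again a separated integrand, so the same fibre formula
    verifies absolute integrability.\<close>
  have nrm: "\<bar>polar_integrand \<alpha> \<gamma> \<kappa> G h z\<bar>
      = polar_integrand \<alpha> \<gamma> \<kappa> (\<lambda>s. \<bar>G s\<bar>) (\<lambda>u. \<bar>h u\<bar>) z" for z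
    by (simp add: polar_integrand_def weight_def abs_mult split: prod.split)
  define P where "P = (\<lambda>(s, y). polar_integrand \<alpha> \<gamma> \<kappa> G h (s - y, y))"
  have P [measurable]: "P \<in> borel_measurable (borel \<Otimes>\<^sub>M borel)"
    unfolding P_def by measurable
  have P_int: "integrable (lborel \<Otimes>\<^sub>M lborel) P"
  proof (rule lborel_pair.Fubini_integrable)
    show "P \<in> borel_measurable (lborel \<Otimes>\<^sub>M lborel)" by measurable
    have "(\<lambda>s. LBINT y. norm (P (s, y)))
        = (\<lambda>s. beta_weight (2 * \<alpha> + 2 * \<kappa> + 2) \<gamma> s * \<bar>G s\<bar> * (J' / 2 / 2 powr (2 * \<alpha> + 1)))"
      by (simp add: P_def nrm has_bochner_integral_integral_eq[OF fibre[OF J']])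
    thus "integrable lborel (\<lambda>s. LBINT y. norm (P (s, y)))"
      using I' by (auto simp: has_bochner_integral_iff)
    show "AE s in lborel. integrable lborel (\<lambda>y. P (s, y))"
      using fibre[OF J] by (simp add: P_def has_bochner_integral_iff)
  qed
  have "integral\<^sup>L (lborel \<Otimes>\<^sub>M lborel) P = (LBINT s. LBINT y. P (s, y))"
    by (rule lborel_pair.integral_fst'[symmetric, OF P_int])
  also have "\<dots> = (LBINT s. beta_weight (2 * \<alpha> + 2 * \<kappa> + 2) \<gamma> s * G s * (J / 2 / 2 powr (2 * \<alpha> + 1)))"
    by (simp add: P_def has_bochner_integral_integral_eq[OF fibre[OF J]])
  also have "\<dots> = I * J / 2 powr (2 * \<alpha> + 2)"
    using I by (simp add: has_bochner_integral_iff c)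
  finally have "has_bochner_integral lborel P (I * J / 2 powr (2 * \<alpha> + 2))"
    using P_int by (simp add: has_bochner_integral_iff lborel_prod)
  \<comment> \<open>\<open>P\<close> is the integrand composed with the area-preserving shear, so
    the value carries over to (x, y).\<close>
  hence "has_bochner_integral (distr lborel lborel (\<lambda>(s, y). (s - y, y)))
      (polar_integrand \<alpha> \<gamma> \<kappa> G h) (I * J / 2 powr (2 * \<alpha> + 2))"
    using borel_measurable_polar_integrand[OF assms(1,2)]
    by (intro has_bochner_integral_distr)
       (simp_all add: P_def case_prod_unfold borel_prod borel_measurable_continuous_onI continuous_intros)
  thus ?thesis unfolding distr_lborel_shear .
qed

subsection \<open>Orthogonality\<close>

lemma continuous_on_jacobi [continuous_intros]: "continuous_on A (jacobi n a b)"
  unfolding jacobi_def by (intro continuous_intros) simp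

lemma borel_measurable_jacobi [measurable]: "jacobi n a b \<in> borel_measurable borel"
  by (intro borel_measurable_continuous_onI continuous_on_jacobi)

text \<open>A continuous G is bounded on the compact unit interval. This serves the integral over s
  when k and l differ, where no closed form is available.\<close>

lemma integrable_beta_weight_mult:
  assumes "a > -1" "b > -1" "continuous_on UNIV G"
  shows "integrable lborel (\<lambda>u. beta_weight a b u * G u)"
proof -
  have "compact (G ` {0..1})"
    by (intro compact_continuous_image continuous_on_subset[OF assms(3)]) auto
  then obtain K where K: "\<And>u. u \<in> {0..1} \<Longrightarrow> \<bar>G u\<bar> \<le> K"
    by (fastforce simp: bounded_iff dest!: compact_imp_bounded)
  have [measurable]: "G \<in> borel_measurable borel"
    by (rule borel_measurable_continuous_onI[OF assms(3)])
  show ?thesis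
  proof (rule Bochner_Integration.integrable_bound)
    show "integrable lborel (\<lambda>u. beta_weight a b u * K)"
      using has_bochner_integral_beta_weight[OF assms(1,2)] by (simp add: has_bochner_integral_iff)
    show "AE u in lborel. norm (beta_weight a b u * G u) \<le> norm (beta_weight a b u * K)"
    proof (rule AE_I2)
      fix u
      have "beta_weight a b u = 0 \<or> \<bar>G u\<bar> \<le> \<bar>K\<bar>"
        using K[of u] by (cases "u \<in> {0..1}") (auto simp: beta_weight_def)
      thus "norm (beta_weight a b u * G u) \<le> norm (beta_weight a b u * K)"
        by (elim disjE) (simp_all add: abs_mult mult_left_mono)
    qed
  qed measurable
qed

lemma S_product_eq_polar_integrand:
  "indicator half_triangle z * (S \<alpha> \<gamma> \<kappa> n k z * S \<alpha> \<gamma> \<kappa> m l z * weight \<alpha> \<gamma> \<kappa> z)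
     = polar_integrand \<alpha> \<gamma> \<kappa>
         (\<lambda>s. s ^ (2 * k + 2 * l) * (jacobi n (alpha_idx \<alpha> \<kappa> k) \<gamma> (1 - 2 * s)
               * jacobi m (alpha_idx \<alpha> \<kappa> l) \<gamma> (1 - 2 * s)))
         (\<lambda>u. jacobi k \<kappa> \<alpha> (1 - 2 * u) * jacobi l \<kappa> \<alpha> (1 - 2 * u)) z"
proof (cases z)
  case (Pair x y)
  have "1 - 2 * x - 2 * y = 1 - 2 * (x + y)" by simp
  thus ?thesis
    unfolding Pair polar_integrand_def S_def alpha_idx_def power_add power_divide
    by (simp only: prod.case fst_conv snd_conv mult_ac)
qed

lemma H_eq:
  "H \<alpha> \<gamma> \<kappa> n k
     = pochhammer (alpha_idx \<alpha> \<kappa> 0 + 1) (4 * k) / pochhammer (alpha_idx \<alpha> \<kappa> 0 + \<gamma> + 2) (4 * k)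
       * jacobi_norm n (alpha_idx \<alpha> \<kappa> k) \<gamma> * jacobi_norm k \<kappa> \<alpha>"
  by (simp add: H_def jacobi_norm_def add.commute[of \<kappa>])

text \<open>The integral of the weight over the half triangle, as \<open>weight_integral\<close>
  shows; its reciprocal is \<open>norm_const\<close>.\<close>

definition total_mass :: "real \<Rightarrow> real \<Rightarrow> real \<Rightarrow> real" where
  "total_mass \<alpha> \<gamma> \<kappa>
     = Beta (2 * \<alpha> + 2 * \<kappa> + 3) (\<gamma> + 1) * Beta (\<kappa> + 1) (\<alpha> + 1) / 2 powr (2 * \<alpha> + 2)"

section \<open>Normalization and orthogonality in two variables\<close>

context
  fixes \<alpha> \<gamma> \<kappa> :: real
  \<comment> \<open>The last condition says that the exponent 2 * \<alpha> + 2 * \<kappa> + 2 of s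
    exceeds -1; hence so does every \<open>alpha_idx \<alpha> \<kappa> j\<close>.\<close>
  assumes par: "\<alpha> > -1" "\<gamma> > -1" "\<kappa> > -1" "\<alpha> + \<kappa> > - (3 / 2)"
begin

lemma total_mass_pos: "total_mass \<alpha> \<gamma> \<kappa> > 0"
  using par by (simp add: total_mass_def Beta_def Gamma_real_pos)

lemma weight_integral:
  "has_bochner_integral lborel (\<lambda>z. indicator half_triangle z * weight \<alpha> \<gamma> \<kappa> z) (total_mass \<alpha> \<gamma> \<kappa>)"
proof -
  have "has_bochner_integral lborel (polar_integrand \<alpha> \<gamma> \<kappa> (\<lambda>_. 1) (\<lambda>_. 1))
      (Beta (2 * \<alpha> + 2 * \<kappa> + 2 + 1) (\<gamma> + 1) * Beta (\<kappa> + 1) (\<alpha> + 1) / 2 powr (2 * \<alpha> + 2))"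
    using par
    by (intro has_bochner_integral_polar)
       (simp_all only: mult_1_right has_bochner_integral_beta_weight borel_measurable_const)
  thus ?thesis
    by (simp add: polar_integrand_def[abs_def] total_mass_def add_ac)
qed

lemma norm_const_eq: "norm_const \<alpha> \<gamma> \<kappa> = 1 / total_mass \<alpha> \<gamma> \<kappa>"
  using has_bochner_integral_integral_eq[OF weight_integral]
  by (simp add: norm_const_def set_lebesgue_integral_def inverse_eq_divide)

lemma S_orthogonal:
  "has_bochner_integral lborel
     (\<lambda>z. indicator half_triangle z * (S \<alpha> \<gamma> \<kappa> n k z * S \<alpha> \<gamma> \<kappa> m l z * weight \<alpha> \<gamma> \<kappa> z))
     (total_mass \<alpha> \<gamma> \<kappa> * H \<alpha> \<gamma> \<kappa> n k * (if n = m then 1 else 0) * (if k = l then 1 else 0))"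
proof -
  define G where "G = (\<lambda>s. s ^ (2 * k + 2 * l) * (jacobi n (alpha_idx \<alpha> \<kappa> k) \<gamma> (1 - 2 * s)
               * jacobi m (alpha_idx \<alpha> \<kappa> l) \<gamma> (1 - 2 * s)))"
  define h where "h = (\<lambda>u. jacobi k \<kappa> \<alpha> (1 - 2 * u) * jacobi l \<kappa> \<alpha> (1 - 2 * u))"
  have [measurable]: "G \<in> borel_measurable borel" "h \<in> borel_measurable borel"
    unfolding G_def h_def by measurable
  have contG: "continuous_on UNIV G"
    unfolding G_def
    by (intro continuous_intros continuous_on_compose2[OF continuous_on_jacobi[of UNIV]]) auto
  \<comment> \<open>For k different from l only the existence of this integral matters, as the
    integral over u is 0; its value is computed for k = l alone.\<close>
  define I where "I = (LBINT s. beta_weight (2 * \<alpha> + 2 * \<kappa> + 2) \<gamma> s * G s)"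
  have I: "has_bochner_integral lborel (\<lambda>s. beta_weight (2 * \<alpha> + 2 * \<kappa> + 2) \<gamma> s * G s) I"
    unfolding I_def using par
    by (intro has_bochner_integral_integrable integrable_beta_weight_mult contG) auto
  have J: "has_bochner_integral lborel (\<lambda>u. beta_weight \<kappa> \<alpha> u * h u)
      (if k = l then Beta (\<kappa> + 1) (\<alpha> + 1) * jacobi_norm k \<kappa> \<alpha> else 0)"
    unfolding h_def using par by (intro jacobi_orthogonal) auto
  have I_eq: "I = (if n = m then Beta (2 * \<alpha> + 2 * \<kappa> + 3) (\<gamma> + 1)
      * (pochhammer (alpha_idx \<alpha> \<kappa> 0 + 1) (4 * k) / pochhammer (alpha_idx \<alpha> \<kappa> 0 + \<gamma> + 2) (4 * k))
      * jacobi_norm n (alpha_idx \<alpha> \<kappa> k) \<gamma> else 0)" if "k = l"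
  proof -
    \<comment> \<open>With k = l the power is s^(4k), which raises the exponent exactly to the
      Jacobi parameter \<open>alpha_idx \<alpha> \<kappa> k\<close>.\<close>
    have "beta_weight (2 * \<alpha> + 2 * \<kappa> + 2) \<gamma> s * s ^ (2 * k + 2 * l)
        = beta_weight (alpha_idx \<alpha> \<kappa> k) \<gamma> s" for s
      using that beta_weight_mult_power[of "2 * \<alpha> + 2 * \<kappa> + 2" \<gamma> s "4 * k" 0]
      by (simp add: alpha_idx_def algebra_simps)
    hence "(\<lambda>s. beta_weight (2 * \<alpha> + 2 * \<kappa> + 2) \<gamma> s * G s)
        = (\<lambda>s. beta_weight (alpha_idx \<alpha> \<kappa> k) \<gamma> s * (jacobi n (alpha_idx \<alpha> \<kappa> k) \<gamma> (1 - 2 * s)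
               * jacobi m (alpha_idx \<alpha> \<kappa> k) \<gamma> (1 - 2 * s)))"
      using that by (simp add: G_def flip: mult.assoc)
    moreover have "alpha_idx \<alpha> \<kappa> k > -1" using par by (simp add: alpha_idx_def)
    ultimately have "I = (if n = m then Beta (alpha_idx \<alpha> \<kappa> k + 1) (\<gamma> + 1)
        * jacobi_norm n (alpha_idx \<alpha> \<kappa> k) \<gamma> else 0)"
      using has_bochner_integral_integral_eq[OF jacobi_orthogonal[of "alpha_idx \<alpha> \<kappa> k" \<gamma> n m]] par
      by (simp add: I_def)
    \<comment> \<open>The shift of the first Beta argument by 4k produces the leading Pochhammer
      quotient of \<open>H\<close>.\<close>
    moreover have "Beta (alpha_idx \<alpha> \<kappa> k + 1) (\<gamma> + 1) = Beta (2 * \<alpha> + 2 * \<kappa> + 3) (\<gamma> + 1)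
      * (pochhammer (alpha_idx \<alpha> \<kappa> 0 + 1) (4 * k) / pochhammer (alpha_idx \<alpha> \<kappa> 0 + \<gamma> + 2) (4 * k))"
      using Beta_add_nat[of "2 * \<alpha> + 2 * \<kappa> + 3" "\<gamma> + 1" "4 * k" 0] par
      by (simp add: alpha_idx_def algebra_simps)
    ultimately show ?thesis by simp
  qed
  have "has_bochner_integral lborel (polar_integrand \<alpha> \<gamma> \<kappa> G h)
     (I * (if k = l then Beta (\<kappa> + 1) (\<alpha> + 1) * jacobi_norm k \<kappa> \<alpha> else 0) / 2 powr (2 * \<alpha> + 2))"
    by (intro has_bochner_integral_polar I J) measurable
  moreover have "I * (if k = l then Beta (\<kappa> + 1) (\<alpha> + 1) * jacobi_norm k \<kappa> \<alpha> else 0)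
        / 2 powr (2 * \<alpha> + 2)
      = total_mass \<alpha> \<gamma> \<kappa> * H \<alpha> \<gamma> \<kappa> n k * (if n = m then 1 else 0) * (if k = l then 1 else 0)"
    using I_eq by (simp add: total_mass_def H_eq mult_ac)
  ultimately show ?thesis
    unfolding S_product_eq_polar_integrand G_def h_def by simp
qed

lemma H_pos: "H \<alpha> \<gamma> \<kappa> n k > 0"
proof -
  have "alpha_idx \<alpha> \<kappa> j > -1" for j using par by (simp add: alpha_idx_def)
  moreover from this[of 0] have "pochhammer (alpha_idx \<alpha> \<kappa> 0 + 1) (4 * k) > 0"
    "pochhammer (alpha_idx \<alpha> \<kappa> 0 + \<gamma> + 2) (4 * k) > 0"
    using par by (auto intro!: pochhammer_pos)
  ultimately show ?thesis
    unfolding H_eq using par by (intro mult_pos_pos divide_pos_pos jacobi_norm_pos) auto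
qed

end

section \<open>Polynomiality and conclusion\<close>

lemma S_polynomial_on_half_triangle:
  "\<exists>p. real_polynomial_function p \<and> (\<forall>z\<in>half_triangle. S \<alpha> \<gamma> \<kappa> n k z = p z)"
proof -
  define a where "a = 2 * \<alpha> + 2 * \<kappa> + 4 * real k + 2"
  \<comment> \<open>The denominators are cleared termwise: u^j has denominator (x + y)^(2j) with j
    <= k, so (x + y)^(2k) leaves the power 2(k - j). On the half triangle x + y > 0, so the
    cancellation is legitimate.\<close>
  define p where "p = (\<lambda>z :: real \<times> real.
      (\<Sum>i\<le>n. jacobi_coeff n a \<gamma> i * (fst z + snd z) ^ i)
    * (\<Sum>j\<le>k. jacobi_coeff k \<kappa> \<alpha> j * ((fst z - snd z) ^ (2 * j) * (fst z + snd z) ^ (2 * (k - j)))))"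
  have lin: "real_polynomial_function (fst :: real \<times> real \<Rightarrow> real)"
    "real_polynomial_function (snd :: real \<times> real \<Rightarrow> real)"
    by (intro real_polynomial_function.intros bounded_linear_fst bounded_linear_snd)+
  have "real_polynomial_function p"
    unfolding p_def
    by (intro real_polynomial_function.intros(2-) real_polynomial_function_sum
          real_polynomial_function_power real_polynomial_function_diff lin) auto
  moreover have "S \<alpha> \<gamma> \<kappa> n k z = p z" if "z \<in> half_triangle" for z
  proof -
    obtain x y where z: "z = (x, y)" by (cases z)
    have s: "x + y > 0" using that by (auto simp: z half_triangle_def T2_def)
    have "(x + y) ^ (2 * k) * ((x - y)\<^sup>2 / (x + y)\<^sup>2) ^ j
        = (x - y) ^ (2 * j) * (x + y) ^ (2 * (k - j))" if "j \<le> k" for j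
    proof -
      have "2 * k = 2 * j + 2 * (k - j)" using that by simp
      hence "(x + y) ^ (2 * k) = (x + y) ^ (2 * j) * (x + y) ^ (2 * (k - j))"
        by (metis power_add)
      thus ?thesis using s by (simp add: power_divide flip: power_mult)
    qed
    hence "(x + y) ^ (2 * k) * jacobi k \<kappa> \<alpha> (1 - 2 * ((x - y)\<^sup>2 / (x + y)\<^sup>2))
        = (\<Sum>j\<le>k. jacobi_coeff k \<kappa> \<alpha> j * ((x - y) ^ (2 * j) * (x + y) ^ (2 * (k - j))))"
      unfolding jacobi_eq_sum sum_distrib_left
      by (intro sum.cong) (auto simp: mult.left_commute)
    moreover have "jacobi n a \<gamma> (1 - 2 * x - 2 * y) = (\<Sum>i\<le>n. jacobi_coeff n a \<gamma> i * (x + y) ^ i)"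
      unfolding jacobi_eq_sum[symmetric] by (simp add: algebra_simps)
    moreover have "S \<alpha> \<gamma> \<kappa> n k z = jacobi n a \<gamma> (1 - 2 * x - 2 * y)
        * ((x + y) ^ (2 * k) * jacobi k \<kappa> \<alpha> (1 - 2 * ((x - y)\<^sup>2 / (x + y)\<^sup>2)))"
      unfolding z S_def a_def prod.case by (simp only: mult_ac)
    ultimately show ?thesis
      by (simp only: z p_def fst_conv snd_conv)
  qed
  ultimately show ?thesis by blast
qed

theorem theorem6p2:
  fixes \<alpha> \<gamma> \<kappa> :: real
  assumes "\<alpha> > -1" and "\<gamma> > -1" and "\<kappa> > -1" and "\<alpha> + \<kappa> > - (3 / 2)"
  shows "mutually_orthogonal_polynomial_system (weight \<alpha> \<gamma> \<kappa>) half_triangle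
           (\<lambda>(n, k). S \<alpha> \<gamma> \<kappa> n k)
       \<and> (\<forall>n k m l. norm_const \<alpha> \<gamma> \<kappa>
            * (LINT z:half_triangle|lborel. S \<alpha> \<gamma> \<kappa> n k z * S \<alpha> \<gamma> \<kappa> m l z * weight \<alpha> \<gamma> \<kappa> z)
          = H \<alpha> \<gamma> \<kappa> n k * (if n = m then 1 else 0) * (if k = l then 1 else 0))"
proof -
  note orth = S_orthogonal[OF assms]
  have int: "set_integrable lborel half_triangle
      (\<lambda>z. S \<alpha> \<gamma> \<kappa> n k z * S \<alpha> \<gamma> \<kappa> m l z * weight \<alpha> \<gamma> \<kappa> z)" for n k m l
    using orth by (simp add: set_integrable_def has_bochner_integral_iff)
  have val: "(LINT z:half_triangle|lborel. S \<alpha> \<gamma> \<kappa> n k z * S \<alpha> \<gamma> \<kappa> m l z * weight \<alpha> \<gamma> \<kappa> z)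
      = total_mass \<alpha> \<gamma> \<kappa> * H \<alpha> \<gamma> \<kappa> n k * (if n = m then 1 else 0) * (if k = l then 1 else 0)"
    for n k m l
    using has_bochner_integral_integral_eq[OF orth] by (simp add: set_lebesgue_integral_def)
  \<comment> \<open>Equal indices give the positive value \<open>total_mass * H\<close>; distinct
    pairs differ in n or in k, so one of the two deltas is 0.\<close>
  have "mutually_orthogonal_polynomial_system (weight \<alpha> \<gamma> \<kappa>) half_triangle (\<lambda>(n, k). S \<alpha> \<gamma> \<kappa> n k)"
    unfolding mutually_orthogonal_polynomial_system_def
    using S_polynomial_on_half_triangle total_mass_pos[OF assms] H_pos[OF assms]
    by (auto simp: int val)
  thus ?thesis
    using total_mass_pos[OF assms] by (simp add: val norm_const_eq[OF assms])
qed

end
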